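(* Let $p$ be a prime, let $q$ be a power of $p$, and let $H\le M(2,q)$ be a cube-free imprimitive subgroup of order $m$, where $p\nmid m$. Let $N_{imp}(m,H)$ be the number of conjugacy classes of imprimitive subgroups of $\mathrm{GL}(2,q)$ of order $m$ that are isomorphic to $H$. Then $N_{imp}(m,H)=1$.
   Context: $\mathbb{F}_q$ is the finite field of order $q$. $D(2,q)$ denotes the subgroup of diagonal matrices of $\mathrm{GL}(2,q)=\mathrm{GL}(2,\mathbb{F}_q)$, and $M(2,q)=D(2,q)\rtimes\langle a\rangle$ is the subgroup of monomial matrices, where $a=\begin{pmatrix}0&1\\1&0\end{pmatrix}$. A group is cube-free if its order is not divisible by the cube of any prime. A subgroup $K\le\mathrm{GL}(2,q)$ is imprimitive if it is irreducible (leaves no one-dimensional subspace of $V=\mathbb{F}_q^2$ invariant) and $V=V_1\oplus V_2$ for some one-dimensional subspaces $V_1,V_2$ that are permuted by $K$. Conjugacy classes of subgroups are taken with respect to conjugation in $\mathrm{GL}(2,q)$. *)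

theory Defs
  imports "HOL-Analysis.Analysis" "HOL-Algebra.Group_Action" "HOL-Algebra.Generated_Groups"
begin

text \<open>
  The field \<open>\<bbbF>\<^sub>q\<close> is a type of classes \<open>field\<close> and \<open>finite\<close> with \<open>q\<close> elements; matrices act
  on column vectors.
\<close>

definition GL2 :: "('a::field^2^2) monoid" where
  "GL2 = \<lparr>carrier = {A. invertible A}, mult = (**), one = mat 1\<rparr>"

lemma group_GL2: "group (GL2 :: ('a::field^2^2) monoid)"
proof (rule groupI)
  fix x y :: "'a^2^2" assume "x \<in> carrier GL2" "y \<in> carrier GL2"
  then show "x \<otimes>\<^bsub>GL2\<^esub> y \<in> carrier GL2"
    by (auto simp: GL2_def invertible_mult)
next
  fix x :: "'a^2^2" assume "x \<in> carrier GL2"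
  then show "\<exists>y\<in>carrier GL2. y \<otimes>\<^bsub>GL2\<^esub> x = \<one>\<^bsub>GL2\<^esub>"
    by (auto simp: GL2_def invertible_def)
qed (auto simp: GL2_def invertible_def matrix_mul_assoc intro: exI[of _ "mat 1"])

definition D2 :: "('a::field^2^2) set" where
  "D2 = {A \<in> carrier GL2. \<forall>i j. i \<noteq> j \<longrightarrow> A $ i $ j = 0}"

definition swap_mat :: "'a::field^2^2" where
  "swap_mat = vector [vector [0, 1], vector [1, 0]]"

definition M2 :: "('a::field^2^2) set" where
  "M2 = D2 <#>\<^bsub>GL2\<^esub> generate GL2 {swap_mat}"

definition cube_free_group :: "('g, 'b) monoid_scheme \<Rightarrow> bool" where
  "cube_free_group G \<longleftrightarrow> (\<forall>r::nat. prime r \<longrightarrow> \<not> r ^ 3 dvd order G)"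

abbreviation subgrp :: "('a::field^2^2) set \<Rightarrow> ('a^2^2) monoid" where
  "subgrp K \<equiv> GL2\<lparr>carrier := K\<rparr>"

definition line :: "('a::field^2) set \<Rightarrow> bool" where
  "line W \<longleftrightarrow> vec.subspace W \<and> vec.dim W = 1"

definition irreducible_group :: "('a::field^2^2) set \<Rightarrow> bool" where
  "irreducible_group K \<longleftrightarrow>
     \<not> (\<exists>W. line W \<and> (\<forall>g\<in>K. (*v) g ` W \<subseteq> W))"

definition imprimitive :: "('a::field^2^2) set \<Rightarrow> bool" where
  "imprimitive K \<longleftrightarrow> irreducible_group K \<and>
     (\<exists>V\<^sub>1 V\<^sub>2. line V\<^sub>1 \<and> line V\<^sub>2 \<and>
        {x + y |x y. x \<in> V\<^sub>1 \<and> y \<in> V\<^sub>2} = UNIV \<and> V\<^sub>1 \<inter> V\<^sub>2 = {0} \<and>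
        (\<forall>g\<in>K. (\<lambda>W. (*v) g ` W) ` {V\<^sub>1, V\<^sub>2} = {V\<^sub>1, V\<^sub>2}))"

definition conj_action :: "'a::field^2^2 \<Rightarrow> ('a^2^2) set \<Rightarrow> ('a^2^2) set" where
  "conj_action g K = g <#\<^bsub>GL2\<^esub> K #>\<^bsub>GL2\<^esub> inv\<^bsub>GL2\<^esub> g"

text \<open>
  \<open>orbits\<close> sends each subgroup in the given family to its full \<open>GL2\<close>-orbit under conjugation,
  so its value is a set of conjugacy classes of subgroups.
\<close>

definition N_imp :: "nat \<Rightarrow> ('a::field^2^2) set \<Rightarrow> nat" where
  "N_imp m H = card (orbits GL2
     {K :: ('a^2^2) set. subgroup K GL2 \<and> imprimitive K \<and> order (subgrp K) = m \<and> subgrp K \<cong> subgrp H} conj_action)"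

end

theory Submission
  imports Defs
begin

text \<open>
  Every imprimitive group is conjugate to a group \<open>K\<close> of monomial matrices, and by irreducibility
  its diagonal part \<open>A\<close> is a proper subgroup, so \<open>K = A \<union> cA\<close> for any antidiagonal \<open>c \<in> K\<close>.
  Given an isomorphism \<open>f\<close> between two such groups \<open>H\<close> and \<open>K\<close> of cube-free order, the point is that
  abstract group theory recovers the matrices: first \<open>A\<close> and then \<open>c\<^sup>2\<close> up to squares of scalars.

  As \<open>A\<close> has index two, its order is not divisible by \<open>4\<close>. Conjugation by \<open>c\<close> swaps the two diagonal entries, and
  \<open>A\<close> is the product of its scalar matrices \<open>diag(x, x)\<close> and its matrices \<open>diag(x, 1/x)\<close>
  (\<open>diag2_factorization\<close>); both factors are finite subgroups of the multiplicative group of the field,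
  hence determined by their orders (\<open>finite_mult_group_eqI\<close>). In a noncommutative \<open>K\<close> the
  diagonal part is the only commutative subgroup of index two (\<open>diag_part_eq_if_commutative\<close>), so
  \<open>f\<close> maps one diagonal part onto the other. The two factors are the elements of \<open>A\<close> that
  \<open>c\<close> centralizes and those that it inverts; \<open>f\<close> preserves them, so the orders agree and \<open>H\<close>
  and \<open>K\<close> have the same diagonal part. In a commutative group the diagonal part consists of scalar
  matrices and is determined by its order alone.

  It remains to match the antidiagonal elements. The square of an antidiagonal \<open>c\<close> is a scalar
  \<open>z\<close> in the scalar group \<open>X\<close>; conjugating by diagonal matrices preserves \<open>z\<close> and otherwise changes
  \<open>c\<close> at will, while replacing \<open>c\<close> by \<open>xc\<close> with \<open>x \<in> X\<close> multiplies \<open>z\<close> by \<open>x\<^sup>2\<close>. Hence only the class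
  of \<open>z\<close> modulo squares in \<open>X\<close> matters (\<open>conjugate_if_same_diag_part\<close>), and there are at most
  two classes (\<open>finite_mult_group.same_square_class\<close>). In the noncommutative case \<open>f\<close> preserves
  whether \<open>z\<close> is a square. In the commutative case irreducibility forces \<open>z\<close> to be a nonsquare for
  both groups, since a square root of \<open>z\<close> would be an eigenvalue of \<open>c\<close>.
\<close>

section \<open>Finite multiplicative subgroups of a field\<close>

locale finite_mult_group =
  fixes X :: "'a::field set"
  assumes finite: "finite X"
    and zero_notin: "0 \<notin> X"
    and one_in: "1 \<in> X"
    and mult_in: "x \<in> X \<Longrightarrow> y \<in> X \<Longrightarrow> x * y \<in> X"
begin

lemma power_in: "x \<in> X \<Longrightarrow> x ^ n \<in> X"
  by (induction n) (auto intro: one_in mult_in)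

text \<open>
  Multiplication by \<open>x\<close> permutes \<open>X\<close>, so it leaves the product of all elements unchanged.
\<close>

lemma power_card_eq_1:
  assumes "x \<in> X"
  shows "x ^ card X = 1"
proof -
  have x: "x \<noteq> 0" using assms zero_notin by auto
  have inj: "inj_on ((*) x) X" using x by (auto intro: inj_onI)
  have "(*) x ` X = X"
    using finite inj assms by (intro endo_inj_surj) (auto intro: mult_in)
  then have "\<Prod>X = (\<Prod>y\<in>X. x * y)"
    using prod.reindex[OF inj, of id] by simp
  also have "\<dots> = x ^ card X * \<Prod>X"
    by (simp add: prod.distrib)
  finally show ?thesis
    using finite zero_notin by (metis mult_cancel_right1 prod_zero_iff)
qed

lemma inverse_in:
  assumes "x \<in> X"
  shows "inverse x \<in> X"
proof -
  have "card X > 0" using finite one_in by (auto simp: card_gt_0_iff)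
  then have "x * x ^ (card X - 1) = 1"
    using power_card_eq_1[OF assms] by (simp add: power_eq_if)
  then have "inverse x = x ^ (card X - 1)"
    by (rule inverse_unique)
  then show ?thesis using power_in[OF assms] by simp
qed

lemma divide_in: "x \<in> X \<Longrightarrow> y \<in> X \<Longrightarrow> x / y \<in> X"
  by (auto simp: divide_inverse intro: mult_in inverse_in)

text \<open>
  Since \<open>x ^ (s + 1) = x\<close> and \<open>s + 1\<close> is even, the \<open>(s + 1) / 2\<close>-th power of \<open>x\<close> is a square root.
\<close>

lemma odd_order_imp_square:
  assumes "x \<in> X" "x ^ s = 1" "odd s"
  shows "\<exists>y\<in>X. x = y\<^sup>2"
proof -
  obtain j where "s + 1 = 2 * j" using assms(3) by (auto elim!: evenE simp flip: even_Suc)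
  then have "(x ^ j)\<^sup>2 = x ^ (s + 1)" by (simp add: mult.commute flip: power_mult)
  then have "x = (x ^ j)\<^sup>2" using assms(2) by simp
  then show ?thesis using power_in[OF assms(1)] by blast
qed

text \<open>
  The squares have index at most two. When \<open>4\<close> does not divide the order \<open>2s\<close>, the exponent \<open>s\<close>
  is odd and \<open>x ^ s\<close>, which is \<open>1\<close> or \<open>-1\<close>, decides whether \<open>x\<close> is a square.
\<close>

lemma same_square_class:
  assumes "\<not> 4 dvd card X" "z \<in> X" "w \<in> X"
    and "(\<exists>x\<in>X. z = x\<^sup>2) \<longleftrightarrow> (\<exists>x\<in>X. w = x\<^sup>2)"
  shows "\<exists>x\<in>X. z = w * x\<^sup>2"
proof (cases "\<exists>x\<in>X. z = x\<^sup>2")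
  case True
  then obtain a b where ab: "a \<in> X" "b \<in> X" "z = a\<^sup>2" "w = b\<^sup>2" using assms(4) by auto
  have "b \<noteq> 0" using ab zero_notin by auto
  then have "z = w * (a / b)\<^sup>2" using ab by (simp add: power_divide)
  then show ?thesis using divide_in[OF ab(1,2)] by blast
next
  case False
  then have nsq: "\<not> (\<exists>x\<in>X. z = x\<^sup>2)" "\<not> (\<exists>x\<in>X. w = x\<^sup>2)" using assms(4) by auto
  then have "even (card X)"
    using odd_order_imp_square[OF assms(2) power_card_eq_1[OF assms(2)]] by blast
  then obtain s where s: "card X = 2 * s" by blast
  then have "odd s" using assms(1) by auto
  have minus_one: "x ^ s = -1" if "x \<in> X" "\<not> (\<exists>y\<in>X. x = y\<^sup>2)" for x
  proof -
    have "(x ^ s)\<^sup>2 = 1" using power_card_eq_1[OF that(1)] s by (simp add: power_even_eq)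
    then show ?thesis
      using odd_order_imp_square[OF that(1) _ \<open>odd s\<close>] that(2) by (auto simp: power2_eq_1_iff)
  qed
  have "(z * w) ^ s = 1"
    using minus_one nsq assms(2,3) by (simp add: power_mult_distrib)
  then obtain y where y: "y \<in> X" "z * w = y\<^sup>2"
    using odd_order_imp_square[OF mult_in[OF assms(2,3)] _ \<open>odd s\<close>] by blast
  have "w \<noteq> 0" using assms(3) zero_notin by auto
  then have "z = w * (y / w)\<^sup>2" using y(2) by (simp add: field_simps power2_eq_square)
  then show ?thesis using divide_in[OF y(1) assms(3)] by blast
qed

end

text \<open>
  Both groups consist of all roots of \<open>x ^ n = 1\<close>, where \<open>n\<close> is their order, and a field has at
  most \<open>n\<close> such roots.
\<close>

lemma finite_mult_group_eqI:
  assumes "finite_mult_group X" "finite_mult_group Y" "card X = card Y"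
  shows "X = Y"
proof -
  define p :: "'a poly" where "p = monom 1 (card X) - 1"
  have pos: "card X > 0"
    using finite_mult_group.finite[OF assms(1)] finite_mult_group.one_in[OF assms(1)]
    by (auto simp: card_gt_0_iff)
  have "coeff p (card X) = 1" using pos by (simp add: p_def coeff_monom)
  then have p: "p \<noteq> 0" by auto
  have deg: "degree p \<le> card X"
    unfolding p_def by (rule degree_diff_le) (auto intro: degree_monom_le)
  have roots: "finite {x. poly p x = 0}" "card {x. poly p x = 0} \<le> card X"
    using poly_roots_finite[OF p] card_poly_roots_bound[OF p] deg by auto
  have "X \<subseteq> {x. poly p x = 0}"
    using finite_mult_group.power_card_eq_1[OF assms(1)] by (auto simp: p_def poly_monom)
  then have "X = {x. poly p x = 0}" using roots card_seteq by blast
  moreover have "Y \<subseteq> {x. poly p x = 0}"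
    using finite_mult_group.power_card_eq_1[OF assms(2)] assms(3) by (auto simp: p_def poly_monom)
  then have "Y = {x. poly p x = 0}" using roots card_seteq assms(3) by metis
  ultimately show ?thesis by simp
qed

section \<open>Diagonal and antidiagonal matrices\<close>

lemma GL2_simps [simp]:
  "carrier GL2 = {A. invertible A}" "A \<otimes>\<^bsub>GL2\<^esub> B = A ** B" "\<one>\<^bsub>GL2\<^esub> = mat 1"
  by (auto simp: GL2_def)

definition diag2 :: "'a::field \<Rightarrow> 'a \<Rightarrow> 'a^2^2" where
  "diag2 s t = vector [vector [s, 0], vector [0, t]]"

definition adiag2 :: "'a::field \<Rightarrow> 'a \<Rightarrow> 'a^2^2" where
  "adiag2 s t = vector [vector [0, s], vector [t, 0]]"

lemma diag2_nth [simp]: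
  "diag2 s t $ 1 $ 1 = s" "diag2 s t $ 1 $ 2 = 0" "diag2 s t $ 2 $ 1 = 0" "diag2 s t $ 2 $ 2 = t"
  by (auto simp: diag2_def vector_2)

lemma adiag2_nth [simp]:
  "adiag2 s t $ 1 $ 1 = 0" "adiag2 s t $ 1 $ 2 = s" "adiag2 s t $ 2 $ 1 = t" "adiag2 s t $ 2 $ 2 = 0"
  by (auto simp: adiag2_def vector_2)

lemma mat2_mult [simp]:
  "diag2 s t ** diag2 u v = diag2 (s * u) (t * v)"
  "diag2 s t ** adiag2 u v = adiag2 (s * u) (t * v)"
  "adiag2 s t ** diag2 u v = adiag2 (s * v) (t * u)"
  "adiag2 s t ** adiag2 u v = diag2 (s * v) (t * u)"
  by (auto simp: vec_eq_iff matrix_matrix_mult_def sum_2 forall_2)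

lemma mat2_eq_iff [simp]:
  "diag2 s t = diag2 u v \<longleftrightarrow> s = u \<and> t = v"
  "adiag2 s t = adiag2 u v \<longleftrightarrow> s = u \<and> t = v"
  by (auto simp: vec_eq_iff forall_2)

lemma diag2_eq_adiag2_iff [simp]:
  "diag2 s t = adiag2 u v \<longleftrightarrow> s = 0 \<and> t = 0 \<and> u = 0 \<and> v = 0"
  "adiag2 u v = diag2 s t \<longleftrightarrow> s = 0 \<and> t = 0 \<and> u = 0 \<and> v = 0"
  by (auto simp: vec_eq_iff forall_2)

lemma mat_1_eq_diag2: "mat 1 = diag2 1 1"
  by (auto simp: vec_eq_iff forall_2 mat_def)

lemma invertible_diag2_iff [simp]: "invertible (diag2 s t) \<longleftrightarrow> s \<noteq> 0 \<and> t \<noteq> 0"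
  by (auto simp: invertible_det_nz det_2)

lemma invertible_adiag2_iff [simp]: "invertible (adiag2 s t) \<longleftrightarrow> s \<noteq> 0 \<and> t \<noteq> 0"
  by (auto simp: invertible_det_nz det_2)

text \<open>
  The transposition matrix is an involution, so \<open>M2\<close> consists of the diagonal matrices and their
  products with it.
\<close>

lemma M2_cases:
  assumes "A \<in> M2"
  shows "(\<exists>s t. A = diag2 s t) \<or> (\<exists>s t. A = adiag2 s t)"
proof -
  have swap: "swap_mat = adiag2 1 1" by (simp add: swap_mat_def adiag2_def)
  have sg: "subgroup {diag2 1 1, adiag2 1 1 :: 'a^2^2} GL2"
  proof (rule group.subgroupI[OF group_GL2])
    fix a assume "a \<in> {diag2 1 1, adiag2 1 1 :: 'a^2^2}"
    then show "inv\<^bsub>GL2\<^esub> a \<in> {diag2 1 1, adiag2 1 1}"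
      using group.inv_equality[OF group_GL2, of "a" "a"] by (auto simp: mat_1_eq_diag2)
  qed auto
  have "generate GL2 {swap_mat :: 'a^2^2} \<subseteq> {diag2 1 1, adiag2 1 1}"
    using group.generate_subgroup_incl[OF group_GL2 _ sg] swap by auto
  then obtain D G where "D \<in> D2" "G \<in> {diag2 1 1, adiag2 1 1 :: 'a^2^2}" "A = D ** G"
    using assms unfolding M2_def set_mult_def GL2_simps by blast
  moreover have "D = diag2 (D $ 1 $ 1) (D $ 2 $ 2)"
    using \<open>D \<in> D2\<close> by (auto simp: D2_def vec_eq_iff forall_2)
  ultimately show ?thesis by (metis empty_iff insert_iff mat2_mult(1,2))
qed

global_interpretation GL2: group "GL2 :: ('a::field^2^2) monoid"
  by (rule group_GL2)

lemma inv_diag2: "s \<noteq> 0 \<Longrightarrow> t \<noteq> 0 \<Longrightarrow> inv\<^bsub>GL2\<^esub> (diag2 s t) = diag2 (1 / s) (1 / t)"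
  by (rule GL2.inv_equality) (auto simp: mat_1_eq_diag2)

lemma inv_adiag2: "s \<noteq> 0 \<Longrightarrow> t \<noteq> 0 \<Longrightarrow> inv\<^bsub>GL2\<^esub> (adiag2 s t) = adiag2 (1 / t) (1 / s)"
  by (rule GL2.inv_equality) (auto simp: mat_1_eq_diag2)

lemma card_subgroup_dvd_card:
  fixes S T :: "('a::field^2^2) set"
  assumes "subgroup S GL2" "subgroup T GL2" "S \<subseteq> T"
  shows "card S dvd card T"
proof -
  have "subgroup S (subgrp T)" by (rule GL2.subgroup_incl[OF assms])
  then have "card (rcosets\<^bsub>subgrp T\<^esub> S) * card S = order (subgrp T)"
    by (rule group.lagrange[OF GL2.subgroup_imp_group[OF assms(2)]])
  then have "card (rcosets\<^bsub>subgrp T\<^esub> S) * card S = card T" by (simp add: order_def)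
  then show ?thesis by (metis dvd_triv_right)
qed

section \<open>Monomial groups\<close>

definition diag_part :: "('a::field^2^2) set \<Rightarrow> ('a^2^2) set" where
  "diag_part K = {A \<in> K. \<exists>s t. A = diag2 s t}"

definition scalars :: "('a::field^2^2) set \<Rightarrow> 'a set" where
  "scalars K = {x. diag2 x x \<in> K}"

text \<open>
  This is the group of diagonal elements of determinant one, described by the upper left entry so
  that it becomes a subgroup of the multiplicative group of the field.
\<close>

definition unimodulars :: "('a::field^2^2) set \<Rightarrow> 'a set" where
  "unimodulars K = {x. diag2 x (1 / x) \<in> K}"

text \<open>
  The requirement of an antidiagonal element excludes groups of diagonal matrices, which leave both
  coordinate axes invariant; it makes the diagonal part a subgroup of index two.
\<close>

locale monomial_group =
  fixes K :: "('a::{field,finite}^2^2) set"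
  assumes subgroup: "subgroup K GL2"
    and cases: "A \<in> K \<Longrightarrow> (\<exists>s t. A = diag2 s t) \<or> (\<exists>s t. A = adiag2 s t)"
    and ex_adiag2: "\<exists>s t. adiag2 s t \<in> K"
begin

lemma mult_in: "A \<in> K \<Longrightarrow> B \<in> K \<Longrightarrow> A ** B \<in> K"
  using subgroup.m_closed[OF subgroup] by simp

lemma one_in: "diag2 1 1 \<in> K"
  using subgroup.one_closed[OF subgroup] by (simp add: mat_1_eq_diag2)

lemma invertible: "A \<in> K \<Longrightarrow> invertible A"
  using subgroup.subset[OF subgroup] by auto

lemma diag2_nonzero: "diag2 s t \<in> K \<Longrightarrow> s \<noteq> 0 \<and> t \<noteq> 0"
  using invertible[of "diag2 s t"] by simp

lemma adiag2_nonzero: "adiag2 s t \<in> K \<Longrightarrow> s \<noteq> 0 \<and> t \<noteq> 0"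
  using invertible[of "adiag2 s t"] by simp

lemma diag2_inverse_in: "diag2 s t \<in> K \<Longrightarrow> diag2 (1 / s) (1 / t) \<in> K"
  using subgroup.m_inv_closed[OF subgroup, of "diag2 s t"] diag2_nonzero[of s t]
  by (simp add: inv_diag2)

lemma adiag2_inverse_in: "adiag2 s t \<in> K \<Longrightarrow> adiag2 (1 / t) (1 / s) \<in> K"
  using subgroup.m_inv_closed[OF subgroup, of "adiag2 s t"] adiag2_nonzero[of s t]
  by (simp add: inv_adiag2)

text \<open>
  Conjugation by an antidiagonal element exchanges the two diagonal entries.
\<close>

lemma diag2_swap_in:
  assumes "diag2 s t \<in> K"
  shows "diag2 t s \<in> K"
proof -
  obtain u v where c: "adiag2 u v \<in> K" using ex_adiag2 by blast
  have "adiag2 u v ** diag2 s t ** adiag2 (1 / v) (1 / u) \<in> K"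
    by (intro mult_in c assms adiag2_inverse_in)
  then show ?thesis using adiag2_nonzero[OF c] by simp
qed

lemma diag2_power_in: "diag2 s t \<in> K \<Longrightarrow> diag2 (s ^ n) (t ^ n) \<in> K"
  by (induction n) (use mult_in[of "diag2 s t" "diag2 (s ^ _) (t ^ _)"] one_in in auto)

lemma subgroup_diag_part: "subgroup (diag_part K) GL2"
proof (rule GL2.subgroupI)
  fix A assume "A \<in> diag_part K"
  then obtain s t where A: "A = diag2 s t" "diag2 s t \<in> K" by (auto simp: diag_part_def)
  then show "inv\<^bsub>GL2\<^esub> A \<in> diag_part K"
    using diag2_nonzero[OF A(2)] diag2_inverse_in[OF A(2)] by (auto simp: inv_diag2 diag_part_def)
next
  fix A B assume "A \<in> diag_part K" "B \<in> diag_part K"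
  then show "A \<otimes>\<^bsub>GL2\<^esub> B \<in> diag_part K"
    using mult_in[of A B] by (auto simp: diag_part_def)
next
  show "diag_part K \<subseteq> carrier GL2" using invertible by (simp add: diag_part_def subset_iff)
  show "diag_part K \<noteq> {}" using one_in by (auto simp: diag_part_def)
qed

lemma finite_mult_group_scalars: "finite_mult_group (scalars K)"
proof
  fix x y assume "x \<in> scalars K" "y \<in> scalars K"
  then show "x * y \<in> scalars K" using mult_in[of "diag2 x x" "diag2 y y"] by (simp add: scalars_def)
next
  show "0 \<notin> scalars K" using diag2_nonzero[of 0 0] by (auto simp: scalars_def)
  show "1 \<in> scalars K" using one_in by (simp add: scalars_def)
qed simp

lemma finite_mult_group_unimodulars: "finite_mult_group (unimodulars K)"
proof
  fix x y assume "x \<in> unimodulars K" "y \<in> unimodulars K"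
  then show "x * y \<in> unimodulars K"
    using mult_in[of "diag2 x (1 / x)" "diag2 y (1 / y)"] by (simp add: unimodulars_def)
next
  show "0 \<notin> unimodulars K" using diag2_nonzero[of 0 0] by (auto simp: unimodulars_def)
  show "1 \<in> unimodulars K" using one_in by (simp add: unimodulars_def)
qed simp

lemma in_adiag2_coset:
  assumes "A \<in> K" "A \<notin> diag_part K" "adiag2 u v \<in> K"
  shows "\<exists>s t. diag2 s t \<in> K \<and> A = adiag2 u v ** diag2 s t"
proof -
  obtain a b where A: "A = adiag2 a b" using cases[OF assms(1)] assms(1,2) by (auto simp: diag_part_def)
  have "adiag2 (1 / v) (1 / u) ** A \<in> K" by (intro mult_in adiag2_inverse_in assms)
  then have "diag2 (b / v) (a / u) \<in> K" by (simp add: A)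
  moreover have "A = adiag2 u v ** diag2 (b / v) (a / u)"
    using adiag2_nonzero[OF assms(3)] by (simp add: A)
  ultimately show ?thesis by blast
qed

lemma card_eq_twice_diag_part: "card K = 2 * card (diag_part K)"
proof -
  obtain u v where c: "adiag2 u v \<in> K" using ex_adiag2 by blast
  note nz = adiag2_nonzero[OF c]
  have K: "K = diag_part K \<union> (**) (adiag2 u v) ` diag_part K"
  proof
    show "K \<subseteq> diag_part K \<union> (**) (adiag2 u v) ` diag_part K"
    proof
      fix A assume "A \<in> K"
      then show "A \<in> diag_part K \<union> (**) (adiag2 u v) ` diag_part K"
        using in_adiag2_coset[of A, OF _ _ c] by (cases "A \<in> diag_part K") (auto simp: diag_part_def simp del: mat2_mult)
    qed
    show "diag_part K \<union> (**) (adiag2 u v) ` diag_part K \<subseteq> K"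
      using mult_in[OF c] by (auto simp: diag_part_def)
  qed
  have "diag_part K \<inter> (**) (adiag2 u v) ` diag_part K = {}"
    using nz by (auto simp: diag_part_def dest: diag2_nonzero)
  moreover have "inj_on ((**) (adiag2 u v)) (diag_part K)"
    using nz by (auto simp: inj_on_def diag_part_def)
  ultimately show ?thesis
    by (subst K) (simp add: card_Un_disjoint card_image)
qed

text \<open>
  As in \<open>power_card_eq_1\<close>, multiplication by \<open>diag2 s t\<close> permutes the diagonal part; here the
  product of the upper left entries is compared. The statement about \<open>t\<close> follows by swapping.
\<close>

lemma diag2_power_card_eq_1:
  assumes "diag2 s t \<in> K"
  shows "s ^ card (diag_part K) = 1 \<and> t ^ card (diag_part K) = 1"
proof -
  have "s ^ card (diag_part K) = 1" if st: "diag2 s t \<in> K" for s t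
  proof -
    define P where "P = (\<Prod>A\<in>diag_part K. A $ 1 $ 1)"
    note nz = diag2_nonzero[OF st]
    have inj: "inj_on ((**) (diag2 s t)) (diag_part K)"
      using nz by (auto simp: inj_on_def diag_part_def)
    have "(**) (diag2 s t) ` diag_part K \<subseteq> diag_part K"
      using mult_in[OF st] by (auto simp: diag_part_def)
    then have img: "(**) (diag2 s t) ` diag_part K = diag_part K"
      using inj by (intro endo_inj_surj) auto
    have "P = (\<Prod>A\<in>diag_part K. (diag2 s t ** A) $ 1 $ 1)"
      unfolding P_def using prod.reindex[OF inj, of "\<lambda>A. A $ 1 $ 1"] img by simp
    also have "\<dots> = (\<Prod>A\<in>diag_part K. s * A $ 1 $ 1)"
      by (rule prod.cong) (auto simp: diag_part_def)
    finally have "P = s ^ card (diag_part K) * P" by (simp add: P_def prod.distrib)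
    moreover have "A $ 1 $ 1 \<noteq> 0" if "A \<in> diag_part K" for A
      using that diag2_nonzero by (auto simp: diag_part_def)
    then have "P \<noteq> 0" by (simp add: P_def)
    ultimately show ?thesis by simp
  qed
  then show ?thesis using assms diag2_swap_in[OF assms] by blast
qed

text \<open>
  Swapping the entries yields \<open>diag2 (-1) 1\<close> as well, so all four sign matrices lie in \<open>K\<close>.
\<close>

lemma four_dvd_card_diag_part:
  assumes "diag2 1 (-1) \<in> K" "(-1 :: 'a) \<noteq> 1"
  shows "4 dvd card (diag_part K)"
proof -
  define E where "E = {diag2 1 1, diag2 1 (-1), diag2 (-1) 1, diag2 (-1) (-1 :: 'a)}"
  have "E \<subseteq> diag_part K"
    using assms(1) one_in diag2_swap_in[OF assms(1)] mult_in[OF assms(1) diag2_swap_in[OF assms(1)]]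
    by (auto simp: E_def diag_part_def)
  moreover have "subgroup E GL2"
    by (rule GL2.subgroupI) (auto simp: E_def inv_diag2)
  moreover have "card E = 4"
    using assms(2) assms(2)[symmetric] by (simp add: E_def)
  ultimately show ?thesis using card_subgroup_dvd_card subgroup_diag_part by metis
qed

text \<open>
  A square factors because \<open>diag(s\<^sup>2, t\<^sup>2) = diag(st, st) * diag(s/t, t/s)\<close>. Every diagonal element is a
  square up to a scalar sign: this is clear in odd order, and in order \<open>2i\<close> with \<open>i\<close> odd the \<open>i\<close>-th
  power has entries \<open>1\<close> or \<open>-1\<close>, which must agree because otherwise \<open>four_dvd_card_diag_part\<close>
  applies.
\<close>

lemma diag2_factorization:
  assumes "\<not> 4 dvd card (diag_part K)" "diag2 s t \<in> K"
  shows "\<exists>x\<in>scalars K. \<exists>y\<in>unimodulars K. s = x * y \<and> t = x / y"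
proof -
  define n where "n = card (diag_part K)"
  have pow: "s ^ n = 1" "t ^ n = 1" using diag2_power_card_eq_1[OF assms(2)] by (auto simp: n_def)
  \<comment> \<open>The number \<open>e\<close> is the scalar sign, and \<open>j\<close> is the exponent that produces the square root.\<close>
  obtain j e where je: "e\<^sup>2 = 1" "diag2 e e \<in> K" "s = (s ^ j)\<^sup>2 * e" "t = (t ^ j)\<^sup>2 * e"
  proof (cases "even n")
    case False
    then obtain j where "n + 1 = 2 * j" by (auto elim!: evenE simp flip: even_Suc)
    then have "(x ^ j)\<^sup>2 = x ^ n * x" for x :: 'a
      by (simp add: mult.commute flip: power_mult power_Suc)
    then show ?thesis using that[of 1 j] pow one_in by simp
  next
    case True
    then obtain i where i: "n = 2 * i" by blast
    then have "odd i" using assms(1) n_def by auto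
    then obtain j where "i + 1 = 2 * j" by (auto elim!: evenE simp flip: even_Suc)
    then have sq: "(x ^ j)\<^sup>2 = x ^ i * x" for x :: 'a
      by (simp add: mult.commute flip: power_mult power_Suc)
    have sgn: "(s ^ i)\<^sup>2 = 1" "(t ^ i)\<^sup>2 = 1" using pow by (simp_all add: i mult.commute flip: power_mult)
    have in_K: "diag2 (s ^ i) (t ^ i) \<in> K" by (rule diag2_power_in[OF assms(2)])
    have eq: "s ^ i = t ^ i"
    proof (rule ccontr)
      assume neq: "s ^ i \<noteq> t ^ i"
      have "diag2 1 (-1) \<in> K"
        using sgn neq in_K diag2_swap_in[OF in_K] by (auto simp: power2_eq_1_iff)
      moreover have "(-1::'a) \<noteq> 1" using sgn neq by (auto simp: power2_eq_1_iff)
      ultimately show False using four_dvd_card_diag_part assms(1) by blast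
    qed
    have "x = x ^ i * x * x ^ i" if "(x ^ i)\<^sup>2 = 1" for x :: 'a
      using that by (simp add: power2_eq_square mult_ac)
    then show ?thesis using that[of "s ^ i" j] sgn in_K eq sq by metis
  qed
  have nz: "s \<noteq> 0" "t \<noteq> 0" using diag2_nonzero[OF assms(2)] by auto
  have j1: "diag2 (s ^ j) (t ^ j) \<in> K" by (rule diag2_power_in[OF assms(2)])
  have j2: "diag2 (t ^ j) (s ^ j) \<in> K" by (rule diag2_swap_in[OF j1])
  have "diag2 (s ^ j) (t ^ j) ** diag2 (t ^ j) (s ^ j) ** diag2 e e \<in> K"
    by (intro mult_in j1 j2 je)
  then have x: "s ^ j * t ^ j * e \<in> scalars K" by (simp add: scalars_def mult.commute)
  have "diag2 (s ^ j) (t ^ j) ** diag2 (1 / t ^ j) (1 / s ^ j) \<in> K"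
    by (intro mult_in j1 diag2_inverse_in j2)
  then have y: "s ^ j / t ^ j \<in> unimodulars K" by (simp add: unimodulars_def)
  have "s = (s ^ j * t ^ j * e) * (s ^ j / t ^ j)" "t = (s ^ j * t ^ j * e) / (s ^ j / t ^ j)"
    using nz je(3,4) by (simp_all add: power2_eq_square mult_ac)
  then show ?thesis using x y by blast
qed

lemma commutes_adiag2_iff:
  assumes "adiag2 u v \<in> K"
  shows "diag2 s t ** adiag2 u v = adiag2 u v ** diag2 s t \<longleftrightarrow> s = t"
  using adiag2_nonzero[OF assms] by (auto simp: mult.commute[of s u] mult.commute[of t v])

lemma subgroup_scalar_matrices: "subgroup ((\<lambda>x. diag2 x x) ` scalars K) GL2"
proof -
  interpret X: finite_mult_group "scalars K" by (rule finite_mult_group_scalars)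
  show ?thesis
  proof (rule GL2.subgroupI)
    fix A assume "A \<in> (\<lambda>x. diag2 x x) ` scalars K"
    then show "inv\<^bsub>GL2\<^esub> A \<in> (\<lambda>x. diag2 x x) ` scalars K"
      using X.inverse_in X.zero_notin
      by (metis (no_types, lifting) image_iff inv_diag2 inverse_eq_divide)
  qed (use X.one_in X.mult_in X.zero_notin in auto)
qed

lemma card_scalar_matrices: "card ((\<lambda>x. diag2 x x) ` scalars K) = card (scalars K)"
  by (rule card_image) (auto intro: inj_onI)

lemma card_scalars_dvd: "card (scalars K) dvd card (diag_part K)"
proof -
  have "(\<lambda>x. diag2 x x) ` scalars K \<subseteq> diag_part K" by (auto simp: scalars_def diag_part_def)
  then show ?thesis
    using card_subgroup_dvd_card[OF subgroup_scalar_matrices subgroup_diag_part]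
    by (simp add: card_scalar_matrices)
qed

text \<open>
  Such a group is generated by scalar matrices and one further element.
\<close>

lemma commutative_if_diag_part_scalar:
  assumes "\<And>s t. diag2 s t \<in> K \<Longrightarrow> s = t" "A \<in> K" "B \<in> K"
  shows "A ** B = B ** A"
proof -
  obtain u v where c: "adiag2 u v \<in> K" using ex_adiag2 by blast
  have "(\<exists>x. A = diag2 x x \<or> A = adiag2 u v ** diag2 x x)" if "A \<in> K" for A
    using in_adiag2_coset[OF that _ c] assms(1) that by (auto simp: diag_part_def)
  then show ?thesis using assms(2,3) by (smt (verit) mat2_mult mult.commute mult.left_commute mult.assoc)
qed

text \<open>
  Suppose that \<open>L\<close> contains an antidiagonal \<open>c\<close>. The diagonal elements of \<open>L\<close> commute with \<open>c\<close> and are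
  therefore scalar, so the scalar matrices \<open>S\<close> have index at most two in the diagonal part \<open>A\<close>; the
  index is two, as \<open>K\<close> is not commutative. For a nonscalar \<open>b \<in> A\<close> the swapped matrix lies in the same
  coset \<open>bS\<close>. The scalar \<open>x \<noteq> 1\<close> relating the two satisfies \<open>x\<^sup>2 = 1\<close>, because swapping twice is the
  identity; so \<open>x = -1\<close>. Hence \<open>S\<close> has even order, \<open>A\<close> has order divisible by \<open>4\<close>, and \<open>K\<close> has order
  divisible by \<open>8\<close>.
\<close>

lemma diag_part_eq_if_commutative:
  assumes "\<not> 8 dvd card K" "A \<in> K" "B \<in> K" "A ** B \<noteq> B ** A"
    and L: "subgroup L GL2" "L \<subseteq> K" "card K = 2 * card L"
    and comm: "\<And>A B. A \<in> L \<Longrightarrow> B \<in> L \<Longrightarrow> A ** B = B ** A"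
  shows "L = diag_part K"
proof -
  interpret X: finite_mult_group "scalars K" by (rule finite_mult_group_scalars)
  define S where "S = (\<lambda>x. diag2 x x) ` scalars K"
  have card_S: "card S = card (scalars K)" by (simp add: S_def card_scalar_matrices)
  have card_L: "card L = card (diag_part K)" using L(3) card_eq_twice_diag_part by simp
  have S_D: "S \<subseteq> diag_part K" by (auto simp: S_def scalars_def diag_part_def)
  have "L \<subseteq> diag_part K"
  proof (rule ccontr)
    assume "\<not> L \<subseteq> diag_part K"
    then obtain C where "C \<in> L" "C \<in> K" "C \<notin> diag_part K" using L(2) by blast
    then obtain u v where c: "adiag2 u v \<in> L"
      using cases[of C] by (auto simp: diag_part_def)
    then have cK: "adiag2 u v \<in> K" using L(2) by blast
    have scal: "s = t" if "diag2 s t \<in> L" for s t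
      using comm[OF that c] commutes_adiag2_iff[OF cK] by simp
    have "L \<subseteq> S \<union> (**) (adiag2 u v) ` S"
    proof
      fix A assume A: "A \<in> L"
      show "A \<in> S \<union> (**) (adiag2 u v) ` S"
      proof (cases "A \<in> diag_part K")
        case True
        then show ?thesis using A scal by (auto simp: diag_part_def S_def scalars_def)
      next
        case False
        then obtain s t where st: "diag2 s t \<in> K" "A = adiag2 u v ** diag2 s t"
          using in_adiag2_coset[OF _ False cK] A L(2) by blast
        have "inv\<^bsub>GL2\<^esub> (adiag2 u v) ** A \<in> L"
          using subgroup.m_closed[OF L(1) subgroup.m_inv_closed[OF L(1) c] A] by simp
        then have "diag2 s t \<in> L"
          using adiag2_nonzero[OF cK] by (simp add: st(2) inv_adiag2)
        then have "diag2 s t \<in> S" using scal st(1) by (auto simp: S_def scalars_def)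
        then show ?thesis using st(2) by blast
      qed
    qed
    then have "card L \<le> card (S \<union> (**) (adiag2 u v) ` S)" by (intro card_mono) auto
    also have "\<dots> \<le> card S + card S"
      by (meson add_left_mono card_Un_le card_image_le finite le_trans)
    finally have "card (diag_part K) \<le> 2 * card (scalars K)" using card_L card_S by simp
    moreover obtain b1 b2 where b: "diag2 b1 b2 \<in> K" "b1 \<noteq> b2"
      using commutative_if_diag_part_scalar assms(2-4) by blast
    then have "diag2 b1 b2 \<in> diag_part K - S" by (auto simp: diag_part_def S_def)
    then have "card S < card (diag_part K)" using S_D by (intro psubset_card_mono) auto
    then have "card (scalars K) < card (diag_part K)" by (simp add: card_S)
    moreover obtain k where k: "card (diag_part K) = card (scalars K) * k"
      using card_scalars_dvd by blast
    ultimately have "1 < k \<and> k \<le> 2" by simp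
    then have D2: "card (diag_part K) = 2 * card (scalars K)" using k by (metis One_nat_def Suc_leI le_antisym mult.commute numeral_2_eq_2)
    have bnz: "b1 \<noteq> 0" "b2 \<noteq> 0" using diag2_nonzero[OF b(1)] by auto
    have disj: "S \<inter> (**) (diag2 b1 b2) ` S = {}"
      using b(2) X.zero_notin by (auto simp: S_def)
    have "card ((**) (diag2 b1 b2) ` S) = card S"
      using bnz by (intro card_image) (auto simp: inj_on_def S_def)
    then have "card (S \<union> (**) (diag2 b1 b2) ` S) = card (diag_part K)"
      using disj D2 card_S by (subst card_Un_disjoint) auto
    moreover have "S \<union> (**) (diag2 b1 b2) ` S \<subseteq> diag_part K"
      using mult_in[OF b(1)] by (auto simp: S_def scalars_def diag_part_def)
    ultimately have D: "S \<union> (**) (diag2 b1 b2) ` S = diag_part K"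
      by (intro card_subset_eq) auto
    have "diag2 b2 b1 \<in> diag_part K" using diag2_swap_in[OF b(1)] by (auto simp: diag_part_def)
    moreover have "diag2 b2 b1 \<notin> S" using b(2) by (auto simp: S_def)
    ultimately have "diag2 b2 b1 \<in> (**) (diag2 b1 b2) ` S" using D by blast
    then obtain x where x: "x \<in> scalars K" and "diag2 b2 b1 = diag2 b1 b2 ** diag2 x x"
      unfolding S_def by blast
    then have b1x: "b2 = b1 * x" and b2x: "b1 = b2 * x" unfolding mat2_mult mat2_eq_iff by blast+
    have "b1 * 1 = b1 * x\<^sup>2" using b1x b2x by (metis mult.assoc mult.right_neutral power2_eq_square)
    then have "x\<^sup>2 = 1" using bnz by (metis mult_left_cancel)
    moreover have "x \<noteq> 1" using b1x b(2) by (metis mult.right_neutral)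
    ultimately have "x = -1" "(-1::'a) \<noteq> 1" by (auto simp: power2_eq_1_iff)
    then have "even (card (scalars K))"
      using X.power_card_eq_1[OF x] by (metis power_minus_odd power_one)
    then show False using assms(1) D2 card_eq_twice_diag_part by auto
  qed
  then show ?thesis using card_L by (intro card_subset_eq) auto
qed

end

section \<open>Conjugating monomial groups into each other\<close>

lemma conj_action_eq_image:
  fixes g :: "'a::field^2^2"
  shows "conj_action g K = (\<lambda>A. g ** A ** inv\<^bsub>GL2\<^esub> g) ` K"
  by (auto simp: conj_action_def l_coset_def r_coset_def)

lemma inv_GL2_mult:
  fixes g :: "'a::field^2^2"
  assumes "invertible g"
  shows "inv\<^bsub>GL2\<^esub> g ** g = mat 1" "g ** inv\<^bsub>GL2\<^esub> g = mat 1" "invertible (inv\<^bsub>GL2\<^esub> g)"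
  using GL2.l_inv[of g] GL2.r_inv[of g] GL2.inv_closed[of g] assms by simp_all

lemma conj_inverse_cancel:
  fixes g :: "'a::field^2^2"
  assumes "invertible g"
  shows "inv\<^bsub>GL2\<^esub> g ** (g ** A ** inv\<^bsub>GL2\<^esub> g) ** g = A"
  using inv_GL2_mult[OF assms] by (metis matrix_mul_assoc matrix_mul_lid matrix_mul_rid)

lemma inj_conj:
  fixes g :: "'a::field^2^2"
  assumes "invertible g"
  shows "inj (\<lambda>A. g ** A ** inv\<^bsub>GL2\<^esub> g)"
  using conj_inverse_cancel[OF assms] by (intro inj_on_inverseI)

definition has_common_eigenvector :: "('a::field^2^2) set \<Rightarrow> bool" where
  "has_common_eigenvector K \<longleftrightarrow> (\<exists>w. w \<noteq> 0 \<and> (\<forall>A\<in>K. \<exists>c. A *v w = c *s w))"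

context monomial_group
begin

text \<open>
  The next two characterizations of the factors of the diagonal part use only the group operation
  and an antidiagonal element, so that an isomorphism carries them over.
\<close>

lemma scalar_matrix_iff:
  assumes "A \<in> diag_part K" "adiag2 u v \<in> K"
  shows "A \<in> (\<lambda>x. diag2 x x) ` scalars K \<longleftrightarrow> A ** adiag2 u v = adiag2 u v ** A"
proof -
  obtain s t where A: "A = diag2 s t" "A \<in> K" using assms(1) by (auto simp: diag_part_def)
  have "A \<in> (\<lambda>x. diag2 x x) ` scalars K \<longleftrightarrow> s = t"
    using A by (auto simp: scalars_def)
  then show ?thesis using commutes_adiag2_iff[OF assms(2)] A(1) by blast
qed

lemma unimodular_matrix_iff:
  assumes "A \<in> diag_part K" "adiag2 u v \<in> K"
  shows "A \<in> (\<lambda>x. diag2 x (1 / x)) ` unimodulars K \<longleftrightarrow> A ** adiag2 u v ** A = adiag2 u v"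
proof -
  obtain s t where A: "A = diag2 s t" "A \<in> K" using assms(1) by (auto simp: diag_part_def)
  have nz: "s \<noteq> 0" "t \<noteq> 0" "u \<noteq> 0" "v \<noteq> 0"
    using A diag2_nonzero adiag2_nonzero[OF assms(2)] by auto
  have "A \<in> (\<lambda>x. diag2 x (1 / x)) ` unimodulars K \<longleftrightarrow> t = 1 / s"
    using A by (auto simp: unimodulars_def)
  also have "\<dots> \<longleftrightarrow> s * t = 1" using nz by (auto simp: field_simps)
  also have "\<dots> \<longleftrightarrow> s * u * t = u \<and> t * v * s = v"
    using nz by (auto simp: mult.assoc mult.left_commute[of _ u] mult.left_commute[of _ v] mult.commute[of t s])
  finally show ?thesis by (simp add: A(1))
qed

text \<open>
  The square of an antidiagonal matrix is the scalar matrix of the product of its entries.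
\<close>

lemma adiag2_prod_in_scalars: "adiag2 u v \<in> K \<Longrightarrow> u * v \<in> scalars K"
  using mult_in[of "adiag2 u v" "adiag2 u v"] by (simp add: scalars_def mult.commute)

text \<open>
  If \<open>u * v = x\<^sup>2\<close>, then \<open>(u, x)\<close> is an eigenvector of \<open>adiag2 u v\<close> with eigenvalue \<open>x\<close>, and
  scalar matrices preserve every line.
\<close>

lemma not_square_if_diag_part_scalar:
  assumes "\<not> has_common_eigenvector K" "\<And>s t. diag2 s t \<in> K \<Longrightarrow> s = t" "adiag2 u v \<in> K"
  shows "u * v \<noteq> x\<^sup>2"
proof
  assume x: "u * v = x\<^sup>2"
  define w :: "'a^2" where "w = vector [u, x]"
  have w: "w $ 1 = u" "w $ 2 = x" by (simp_all add: w_def)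
  then have "w \<noteq> 0" using adiag2_nonzero[OF assms(3)] by auto
  have diag: "diag2 c c *v w = c *s w" for c
    by (simp add: vec_eq_iff forall_2 matrix_vector_mult_def sum_2)
  have adiag: "adiag2 u v *v w = x *s w"
    using x by (simp add: vec_eq_iff forall_2 matrix_vector_mult_def sum_2 w power2_eq_square mult.commute)
  have "\<exists>c. A *v w = c *s w" if A: "A \<in> K" for A
  proof (cases "A \<in> diag_part K")
    case True
    then obtain s t where "diag2 s t \<in> K" "A = diag2 s t" by (auto simp: diag_part_def)
    then have "A = diag2 s s" using assms(2) by blast
    then show ?thesis using diag by blast
  next
    case False
    then obtain s t where st: "diag2 s t \<in> K" "A = adiag2 u v ** diag2 s t"
      using in_adiag2_coset[OF A _ assms(3)] by blast
    then have "A *v w = adiag2 u v *v (diag2 s s *v w)"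
      using assms(2)[OF st(1)] by (simp only: matrix_vector_mul_assoc)
    also have "\<dots> = (s * x) *s w"
      by (simp add: diag adiag vector_scalar_commute)
    finally show ?thesis by blast
  qed
  then show False using assms(1) \<open>w \<noteq> 0\<close> unfolding has_common_eigenvector_def by blast
qed

end

lemma diag_part_eqI:
  assumes "monomial_group H" "monomial_group K"
    and "\<not> 4 dvd card (diag_part H)" "\<not> 4 dvd card (diag_part K)"
    and "scalars H = scalars K" "unimodulars H = unimodulars K"
  shows "diag_part H = diag_part K"
proof -
  have "diag2 s t \<in> L'"
    if L: "diag2 s t \<in> L" "monomial_group L" "monomial_group L'" "\<not> 4 dvd card (diag_part L)"
      "scalars L = scalars L'" "unimodulars L = unimodulars L'" for s t :: 'a and L L'
  proof -
    obtain x y where xy: "x \<in> scalars L'" "y \<in> unimodulars L'" "s = x * y" "t = x / y"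
      using monomial_group.diag2_factorization[OF L(2,4,1)] L(5,6) by blast
    have "diag2 x x ** diag2 y (1 / y) \<in> L'"
      using xy by (intro monomial_group.mult_in[OF L(3)]) (auto simp: scalars_def unimodulars_def)
    then show ?thesis by (simp add: xy)
  qed
  from this[OF _ assms(1,2,3,5,6)] this[OF _ assms(2,1,4) assms(5)[symmetric] assms(6)[symmetric]]
  show ?thesis by (auto simp: diag_part_def)
qed

text \<open>
  Conjugation by \<open>diag2 r 1\<close> fixes diagonal matrices and turns \<open>adiag2 a b\<close> into
  \<open>adiag2 (r * a) (b / r)\<close>, so it reaches every antidiagonal matrix with the same product of entries.
  The factor \<open>x\<close> is used to adjust that product within \<open>K\<close> beforehand.
\<close>

lemma conjugate_if_same_diag_part:
  assumes "monomial_group H" "monomial_group K" "diag_part H = diag_part K"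
    and "adiag2 u v \<in> H" "adiag2 a b \<in> K" "x \<in> scalars K" "u * v = a * b * x\<^sup>2"
  shows "\<exists>g. invertible g \<and> conj_action g K = H"
proof -
  interpret H: monomial_group H by fact
  interpret K: monomial_group K by fact
  have nz: "u \<noteq> 0" "v \<noteq> 0" "a \<noteq> 0" "b \<noteq> 0" "x \<noteq> 0"
    using H.adiag2_nonzero[OF assms(4)] K.adiag2_nonzero[OF assms(5)] assms(6) K.diag2_nonzero[of x x]
    by (auto simp: scalars_def)
  define r where "r = u / (a * x)"
  define g where "g = diag2 r 1"
  have r: "r \<noteq> 0" using nz by (simp add: r_def)
  then have g: "invertible g" "inv\<^bsub>GL2\<^esub> g = diag2 (1 / r) 1" by (simp_all add: g_def inv_diag2)
  have "adiag2 a b ** diag2 x x \<in> K" using assms(5,6) by (intro K.mult_in) (auto simp: scalars_def)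
  then have c: "adiag2 (a * x) (b * x) \<in> K" by simp
  have ru: "r * (a * x) = u" using nz by (simp add: r_def)
  have "b * x / r = a * b * x\<^sup>2 / u" using nz by (simp add: r_def power2_eq_square mult_ac)
  then have rv: "b * x / r = v" using nz by (simp flip: assms(7))
  have conj_in: "g ** A ** inv\<^bsub>GL2\<^esub> g \<in> H" if A: "A \<in> K" for A
  proof (cases "A \<in> diag_part K")
    case True
    then obtain s t where "A = diag2 s t" by (auto simp: diag_part_def)
    then have "g ** A ** inv\<^bsub>GL2\<^esub> g = A" using r unfolding g(2) by (simp add: g_def)
    moreover have "A \<in> H" using True assms(3) by (auto simp: diag_part_def)
    ultimately show ?thesis by simp
  next
    case False
    then obtain s t where st: "diag2 s t \<in> K" "A = adiag2 (a * x) (b * x) ** diag2 s t"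
      using K.in_adiag2_coset[OF A _ c] by blast
    have "g ** A ** inv\<^bsub>GL2\<^esub> g = adiag2 (r * (a * x) * t) (b * x / r * s)"
      unfolding g(2) st(2) by (simp add: g_def mult_ac)
    also have "\<dots> = adiag2 u v ** diag2 s t" unfolding ru rv by simp
    finally have eq: "g ** A ** inv\<^bsub>GL2\<^esub> g = adiag2 u v ** diag2 s t" .
    have "diag2 s t \<in> diag_part H" using st(1) assms(3) by (auto simp: diag_part_def)
    then show ?thesis unfolding eq using assms(4) by (intro H.mult_in) (auto simp: diag_part_def)
  qed
  have "card (conj_action g K) = card K"
    unfolding conj_action_eq_image by (intro card_image inj_on_subset[OF inj_conj[OF g(1)]]) simp
  then have "card (conj_action g K) = card H"
    using H.card_eq_twice_diag_part K.card_eq_twice_diag_part assms(3) by simp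
  moreover have "conj_action g K \<subseteq> H" using conj_in by (auto simp: conj_action_eq_image)
  ultimately have "conj_action g K = H" by (intro card_subset_eq) auto
  then show ?thesis using g(1) by blast
qed

text \<open>
  Cube-freeness enters in the form that \<open>8\<close> does not divide the order, which means that \<open>4\<close> does not
  divide the order of the diagonal part.
\<close>

locale isomorphic_monomial_groups =
  H: monomial_group H + K: monomial_group K for H K :: "('a::{field,finite}^2^2) set" +
  fixes f :: "'a^2^2 \<Rightarrow> 'a^2^2"
  assumes iso: "f \<in> iso (subgrp H) (subgrp K)"
    and cube_free_at_2: "\<not> 8 dvd card H"
begin

lemma f_mult: "A \<in> H \<Longrightarrow> B \<in> H \<Longrightarrow> f (A ** B) = f A ** f B"
  using iso by (auto simp: iso_def hom_def)

lemma bij: "bij_betw f H K"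
  using iso by (auto simp: iso_def)

lemma f_in: "A \<in> H \<Longrightarrow> f A \<in> K"
  using bij by (rule bij_betwE[rule_format])

lemma f_eq_iff: "A \<in> H \<Longrightarrow> B \<in> H \<Longrightarrow> f A = f B \<longleftrightarrow> A = B"
  using bij by (auto simp: bij_betw_def inj_on_def)

lemma f_surj: "B \<in> K \<Longrightarrow> \<exists>A\<in>H. B = f A"
  using bij by (auto simp: bij_betw_def)

lemma card_eq: "card H = card K"
  using bij by (rule bij_betw_same_card)

lemma card_diag_part_eq: "card (diag_part H) = card (diag_part K)"
  using card_eq H.card_eq_twice_diag_part K.card_eq_twice_diag_part by simp

lemma not_four_dvd_card_diag_part:
  "\<not> 4 dvd card (diag_part H)" "\<not> 4 dvd card (diag_part K)"
  using cube_free_at_2 card_eq H.card_eq_twice_diag_part K.card_eq_twice_diag_part by auto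

lemma not_four_dvd_card_scalars: "\<not> 4 dvd card (scalars K)"
  using not_four_dvd_card_diag_part(2) K.card_scalars_dvd by (metis dvd_trans)

text \<open>
  Here an antidiagonal element commutes with the diagonal part, which is thus scalar. The isomorphism
  may fail to respect diagonal parts, so these are compared through their orders, and the antidiagonal
  elements through the fact that their products of entries are nonsquares in both groups.
\<close>

lemma conjugate_if_commutative:
  assumes comm: "\<And>A B. A \<in> H \<Longrightarrow> B \<in> H \<Longrightarrow> A ** B = B ** A"
    and "\<not> has_common_eigenvector H" "\<not> has_common_eigenvector K"
  shows "\<exists>g. invertible g \<and> conj_action g K = H"
proof -
  obtain u v where c: "adiag2 u v \<in> H" using H.ex_adiag2 by blast
  obtain a b where c': "adiag2 a b \<in> K" using K.ex_adiag2 by blast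
  have commK: "A ** B = B ** A" if AB: "A \<in> K" "B \<in> K" for A B
  proof -
    obtain A' B' where "A' \<in> H" "B' \<in> H" "A = f A'" "B = f B'" using f_surj AB by metis
    then show ?thesis using comm f_mult by metis
  qed
  have scalH: "s = t" if "diag2 s t \<in> H" for s t
    using H.commutes_adiag2_iff[OF c] comm[OF that c] by blast
  have scalK: "s = t" if "diag2 s t \<in> K" for s t
    using K.commutes_adiag2_iff[OF c'] commK[OF that c'] by blast
  have dH: "diag_part H = (\<lambda>x. diag2 x x) ` scalars H"
    using scalH by (auto simp: diag_part_def scalars_def)
  have dK: "diag_part K = (\<lambda>x. diag2 x x) ` scalars K"
    using scalK by (auto simp: diag_part_def scalars_def)
  have "card (scalars H) = card (scalars K)"
    using card_diag_part_eq unfolding dH dK H.card_scalar_matrices K.card_scalar_matrices .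
  then have eq: "scalars H = scalars K"
    by (rule finite_mult_group_eqI[OF H.finite_mult_group_scalars K.finite_mult_group_scalars])
  have "\<exists>x\<in>scalars K. u * v = a * b * x\<^sup>2"
  proof (rule finite_mult_group.same_square_class[OF K.finite_mult_group_scalars not_four_dvd_card_scalars])
    show "u * v \<in> scalars K" using H.adiag2_prod_in_scalars[OF c] eq by simp
    show "a * b \<in> scalars K" by (rule K.adiag2_prod_in_scalars[OF c'])
    show "(\<exists>x\<in>scalars K. u * v = x\<^sup>2) = (\<exists>x\<in>scalars K. a * b = x\<^sup>2)"
      using H.not_square_if_diag_part_scalar[OF assms(2) scalH c]
        K.not_square_if_diag_part_scalar[OF assms(3) scalK c'] by blast
  qed
  moreover have "diag_part H = diag_part K" unfolding dH dK eq ..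
  ultimately show ?thesis
    using conjugate_if_same_diag_part[OF H.monomial_group_axioms K.monomial_group_axioms _ c c'] by blast
qed

lemma image_diag_part:
  assumes "A \<in> H" "B \<in> H" "A ** B \<noteq> B ** A"
  shows "f ` diag_part H = diag_part K"
proof (rule K.diag_part_eq_if_commutative)
  have sub: "diag_part H \<subseteq> H" by (auto simp: diag_part_def)
  show "\<not> 8 dvd card K" using cube_free_at_2 card_eq by simp
  show "f A \<in> K" "f B \<in> K" using assms f_in by auto
  show "f A ** f B \<noteq> f B ** f A"
    using assms f_eq_iff[OF H.mult_in[OF assms(1,2)] H.mult_in[OF assms(2,1)]] f_mult by metis
  show "f ` diag_part H \<subseteq> K" using sub f_in by auto
  have "card (f ` diag_part H) = card (diag_part H)"
    using bij sub by (intro card_image) (auto simp: bij_betw_def intro: inj_on_subset)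
  then show "card K = 2 * card (f ` diag_part H)"
    using H.card_eq_twice_diag_part card_eq by simp
  show "A' ** B' = B' ** A'" if "A' \<in> f ` diag_part H" "B' \<in> f ` diag_part H" for A' B'
  proof -
    obtain s t s' t' where st: "diag2 s t \<in> H" "diag2 s' t' \<in> H" "A' = f (diag2 s t)" "B' = f (diag2 s' t')"
      using \<open>A' \<in> _\<close> \<open>B' \<in> _\<close> by (auto simp: diag_part_def)
    have "A' ** B' = f (diag2 s t ** diag2 s' t')" using st f_mult by metis
    also have "\<dots> = f (diag2 s' t' ** diag2 s t)" by (simp add: mult.commute)
    also have "\<dots> = B' ** A'" using st f_mult by metis
    finally show ?thesis .
  qed
  interpret f: group_hom "subgrp H" "subgrp K" f
    using iso GL2.subgroup_imp_group[OF H.subgroup] GL2.subgroup_imp_group[OF K.subgroup]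
    by (auto simp: group_hom_def group_hom_axioms_def iso_def)
  have "subgroup (diag_part H) (subgrp H)"
    by (rule GL2.subgroup_incl[OF H.subgroup_diag_part H.subgroup sub])
  then have "subgroup (f ` diag_part H) (subgrp K)"
    by (rule f.subgroup_img_is_subgroup)
  then show "subgroup (f ` diag_part H) GL2"
    by (rule GL2.incl_subgroup[OF K.subgroup])
qed

text \<open>
  Here \<open>f\<close> respects diagonal parts, scalar matrices and unimodular diagonal matrices. The antidiagonal
  elements to be compared are \<open>c\<close> and \<open>f c\<close>: as \<open>f\<close> maps \<open>c\<^sup>2\<close> to \<open>(f c)\<^sup>2\<close>, both squares are squares of
  scalar matrices of their groups or neither is.
\<close>

lemma conjugate_if_not_commutative:
  assumes "A \<in> H" "B \<in> H" "A ** B \<noteq> B ** A"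
  shows "\<exists>g. invertible g \<and> conj_action g K = H"
proof -
  note img = image_diag_part[OF assms]
  have sub: "diag_part H \<subseteq> H" by (auto simp: diag_part_def)
  obtain u v where c: "adiag2 u v \<in> H" using H.ex_adiag2 by blast
  have "adiag2 u v \<notin> diag_part H" using H.adiag2_nonzero[OF c] by (auto simp: diag_part_def)
  then have "f (adiag2 u v) \<notin> diag_part K"
    unfolding img[symmetric] using f_eq_iff[OF c] sub by blast
  then obtain a b where ab: "f (adiag2 u v) = adiag2 a b"
    using K.cases[OF f_in[OF c]] f_in[OF c] by (auto simp: diag_part_def)
  then have c': "adiag2 a b \<in> K" using f_in[OF c] by simp
  have image_eq: "f ` P = Q"
    if "P \<subseteq> diag_part H" "Q \<subseteq> diag_part K" "\<And>A. A \<in> diag_part H \<Longrightarrow> A \<in> P \<longleftrightarrow> f A \<in> Q" for P Q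
  proof
    show "f ` P \<subseteq> Q" using that(1,3) by auto
    show "Q \<subseteq> f ` P"
    proof
      fix B assume "B \<in> Q"
      moreover from this have "B \<in> f ` diag_part H" using that(2) img by auto
      ultimately show "B \<in> f ` P" using that(3) by auto
    qed
  qed
  have card_image_f: "card (f ` P) = card P" if "P \<subseteq> diag_part H" for P
    using bij that sub by (intro card_image) (auto simp: bij_betw_def intro: inj_on_subset)
  have scal_img: "f ` (\<lambda>x. diag2 x x) ` scalars H = (\<lambda>x. diag2 x x) ` scalars K"
  proof (rule image_eq)
    fix A assume A: "A \<in> diag_part H"
    then have AH: "A \<in> H" and fA: "f A \<in> diag_part K" using sub img by auto
    have "A \<in> (\<lambda>x. diag2 x x) ` scalars H \<longleftrightarrow> f (A ** adiag2 u v) = f (adiag2 u v ** A)"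
      unfolding H.scalar_matrix_iff[OF A c] using f_eq_iff H.mult_in AH c by metis
    also have "\<dots> \<longleftrightarrow> f A ** adiag2 a b = adiag2 a b ** f A"
      using f_mult AH c ab by metis
    finally show "A \<in> (\<lambda>x. diag2 x x) ` scalars H \<longleftrightarrow> f A \<in> (\<lambda>x. diag2 x x) ` scalars K"
      unfolding K.scalar_matrix_iff[OF fA c'] .
  qed (auto simp: scalars_def diag_part_def)
  have uni_img: "f ` (\<lambda>x. diag2 x (1 / x)) ` unimodulars H = (\<lambda>x. diag2 x (1 / x)) ` unimodulars K"
  proof (rule image_eq)
    fix A assume A: "A \<in> diag_part H"
    then have AH: "A \<in> H" and fA: "f A \<in> diag_part K" using sub img by auto
    have "A \<in> (\<lambda>x. diag2 x (1 / x)) ` unimodulars H \<longleftrightarrow> f (A ** adiag2 u v ** A) = f (adiag2 u v)"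
      unfolding H.unimodular_matrix_iff[OF A c] using f_eq_iff H.mult_in AH c by metis
    also have "\<dots> \<longleftrightarrow> f A ** adiag2 a b ** f A = adiag2 a b"
      using f_mult H.mult_in AH c ab by metis
    finally show "A \<in> (\<lambda>x. diag2 x (1 / x)) ` unimodulars H \<longleftrightarrow> f A \<in> (\<lambda>x. diag2 x (1 / x)) ` unimodulars K"
      unfolding K.unimodular_matrix_iff[OF fA c'] .
  qed (auto simp: unimodulars_def diag_part_def)
  have "card ((\<lambda>x. diag2 x x) ` scalars H) = card ((\<lambda>x. diag2 x x) ` scalars K)"
  proof -
    have "(\<lambda>x. diag2 x x) ` scalars H \<subseteq> diag_part H" by (auto simp: scalars_def diag_part_def)
    from card_image_f[OF this] show ?thesis unfolding scal_img by (rule sym)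
  qed
  then have "card (scalars H) = card (scalars K)"
    by (simp add: H.card_scalar_matrices K.card_scalar_matrices)
  then have scal_eq: "scalars H = scalars K"
    by (rule finite_mult_group_eqI[OF H.finite_mult_group_scalars K.finite_mult_group_scalars])
  have card_uni: "card ((\<lambda>x. diag2 x (1 / x)) ` X) = card X" for X :: "'a set"
    by (rule card_image) (auto intro: inj_onI)
  have "card ((\<lambda>x. diag2 x (1 / x)) ` unimodulars H) = card ((\<lambda>x. diag2 x (1 / x)) ` unimodulars K)"
  proof -
    have "(\<lambda>x. diag2 x (1 / x)) ` unimodulars H \<subseteq> diag_part H"
      by (auto simp: unimodulars_def diag_part_def)
    from card_image_f[OF this] show ?thesis unfolding uni_img by (rule sym)
  qed
  then have "card (unimodulars H) = card (unimodulars K)" by (simp only: card_uni)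
  then have uni_eq: "unimodulars H = unimodulars K"
    by (rule finite_mult_group_eqI[OF H.finite_mult_group_unimodulars K.finite_mult_group_unimodulars])
  have "diag_part H = diag_part K"
    by (rule diag_part_eqI[OF H.monomial_group_axioms K.monomial_group_axioms
          not_four_dvd_card_diag_part scal_eq uni_eq])
  moreover have "\<exists>x\<in>scalars K. u * v = a * b * x\<^sup>2"
  proof (rule finite_mult_group.same_square_class[OF K.finite_mult_group_scalars not_four_dvd_card_scalars])
    show "u * v \<in> scalars K" using H.adiag2_prod_in_scalars[OF c] scal_eq by simp
    show "a * b \<in> scalars K" by (rule K.adiag2_prod_in_scalars[OF c'])
    have zH: "diag2 (u * v) (u * v) \<in> H" using H.adiag2_prod_in_scalars[OF c] by (simp add: scalars_def)
    have "f (adiag2 u v ** adiag2 u v) = adiag2 a b ** adiag2 a b" using f_mult c ab by metis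
    then have fz: "f (diag2 (u * v) (u * v)) = diag2 (a * b) (a * b)" by (simp add: mult.commute)
    have sq: "u * v = x\<^sup>2 \<longleftrightarrow> a * b = y\<^sup>2"
      if "x \<in> scalars H" "f (diag2 x x) = diag2 y y" for x y
    proof -
      have xH: "diag2 x x \<in> H" using that by (simp add: scalars_def)
      have "u * v = x\<^sup>2 \<longleftrightarrow> diag2 (u * v) (u * v) = diag2 x x ** diag2 x x"
        by (simp add: power2_eq_square)
      also have "\<dots> \<longleftrightarrow> f (diag2 (u * v) (u * v)) = f (diag2 x x ** diag2 x x)"
        using f_eq_iff[OF zH H.mult_in[OF xH xH]] by blast
      also have "\<dots> \<longleftrightarrow> a * b = y\<^sup>2"
        unfolding f_mult[OF xH xH] fz that(2) by (simp add: power2_eq_square)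
      finally show ?thesis .
    qed
    have "\<exists>y\<in>scalars K. f (diag2 x x) = diag2 y y" if "x \<in> scalars H" for x
      using scal_img that by blast
    moreover have "\<exists>x\<in>scalars H. f (diag2 x x) = diag2 y y" if "y \<in> scalars K" for y
    proof -
      have "diag2 y y \<in> f ` (\<lambda>x. diag2 x x) ` scalars H" unfolding scal_img using that by blast
      then show ?thesis by force
    qed
    ultimately show "(\<exists>x\<in>scalars K. u * v = x\<^sup>2) = (\<exists>x\<in>scalars K. a * b = x\<^sup>2)"
      using sq unfolding scal_eq by metis
  qed
  ultimately show ?thesis
    using conjugate_if_same_diag_part[OF H.monomial_group_axioms K.monomial_group_axioms _ c c'] by blast
qed

lemma conjugate:
  assumes "\<not> has_common_eigenvector H" "\<not> has_common_eigenvector K"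
  shows "\<exists>g. invertible g \<and> conj_action g K = H"
  using conjugate_if_commutative[OF _ assms] conjugate_if_not_commutative by blast

end

section \<open>Imprimitive groups\<close>

lemma conj_mult:
  fixes g :: "'a::field^2^2"
  assumes "invertible g"
  shows "g ** A ** inv\<^bsub>GL2\<^esub> g ** (g ** B ** inv\<^bsub>GL2\<^esub> g) = g ** (A ** B) ** inv\<^bsub>GL2\<^esub> g"
proof -
  have "inv\<^bsub>GL2\<^esub> g ** (g ** C) = C" for C :: "'a^2^2"
    by (simp add: matrix_mul_assoc inv_GL2_mult[OF assms])
  then show ?thesis by (simp flip: matrix_mul_assoc)
qed

text \<open>
  Conjugate subgroups are isomorphic, so passing to a monomial conjugate keeps the isomorphism type.
\<close>

lemma conj_action_iso:
  fixes g :: "'a::field^2^2"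
  assumes "invertible g"
  shows "(\<lambda>A. g ** A ** inv\<^bsub>GL2\<^esub> g) \<in> iso (subgrp K) (subgrp (conj_action g K))"
  using conj_mult[OF assms] inj_on_subset[OF inj_conj[OF assms], of K]
  by (auto simp: iso_def hom_def bij_betw_def conj_action_eq_image)

lemma subgroup_conj_action:
  fixes g :: "'a::field^2^2"
  assumes "invertible g" "subgroup K GL2"
  shows "subgroup (conj_action g K) GL2"
proof -
  have "g ** A ** inv\<^bsub>GL2\<^esub> g \<in> carrier GL2" if "A \<in> K" for A
    using subgroup.subset[OF assms(2)] that assms(1) inv_GL2_mult(3)[OF assms(1)]
    by (auto intro!: invertible_mult)
  then have "(\<lambda>A. g ** A ** inv\<^bsub>GL2\<^esub> g) \<in> hom (subgrp K) GL2"
    using conj_mult[OF assms(1)] by (auto simp: hom_def)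
  then interpret group_hom "subgrp K" GL2 "\<lambda>A. g ** A ** inv\<^bsub>GL2\<^esub> g"
    using GL2.subgroup_imp_group[OF assms(2)] GL2.group_axioms
    by (simp add: group_hom_def group_hom_axioms_def)
  show ?thesis using img_is_subgroup by (simp add: conj_action_eq_image)
qed

lemma conj_action_conj_action:
  fixes g h :: "'a::field^2^2"
  assumes "invertible g" "invertible h"
  shows "conj_action g (conj_action h K) = conj_action (g ** h) K"
proof -
  have "inv\<^bsub>GL2\<^esub> (g ** h) = inv\<^bsub>GL2\<^esub> h ** inv\<^bsub>GL2\<^esub> g"
    using GL2.inv_mult_group[of g h] assms by simp
  then show ?thesis by (simp add: conj_action_eq_image image_image matrix_mul_assoc)
qed

lemma orbit_conj_action:
  fixes g :: "'a::field^2^2"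
  assumes g: "invertible g"
  shows "orbit GL2 conj_action (conj_action g K) = orbit GL2 conj_action K"
proof
  have orbit: "orbit GL2 conj_action L = {conj_action h L |h. invertible h}" for L :: "('a^2^2) set"
    by (simp add: orbit_def)
  show "orbit GL2 conj_action (conj_action g K) \<subseteq> orbit GL2 conj_action K"
  proof
    fix L assume "L \<in> orbit GL2 conj_action (conj_action g K)"
    then obtain h where h: "invertible h" "L = conj_action h (conj_action g K)"
      unfolding orbit by blast
    then have "L = conj_action (h ** g) K" "invertible (h ** g)"
      using g conj_action_conj_action invertible_mult by blast+
    then show "L \<in> orbit GL2 conj_action K" unfolding orbit by blast
  qed
  show "orbit GL2 conj_action K \<subseteq> orbit GL2 conj_action (conj_action g K)"
  proof
    fix L assume "L \<in> orbit GL2 conj_action K"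
    then obtain h where h: "invertible h" "L = conj_action h K" unfolding orbit by blast
    have inv: "invertible (h ** inv\<^bsub>GL2\<^esub> g)"
      by (rule invertible_mult[OF h(1) inv_GL2_mult(3)[OF g]])
    have "h ** inv\<^bsub>GL2\<^esub> g ** g = h"
      using inv_GL2_mult(1)[OF g] by (simp flip: matrix_mul_assoc)
    then have "L = conj_action (h ** inv\<^bsub>GL2\<^esub> g) (conj_action g K)"
      unfolding conj_action_conj_action[OF inv g] h(2) by simp
    then show "L \<in> orbit GL2 conj_action (conj_action g K)" using inv unfolding orbit by blast
  qed
qed

lemma has_common_eigenvector_conj_action:
  fixes g :: "'a::field^2^2"
  assumes g: "invertible g" and "has_common_eigenvector (conj_action g K)"
  shows "has_common_eigenvector K"
proof -
  let ?h = "inv\<^bsub>GL2\<^esub> g"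
  obtain w where w: "w \<noteq> 0" "\<And>A. A \<in> K \<Longrightarrow> \<exists>c. (g ** A ** ?h) *v w = c *s w"
    using assms(2) unfolding has_common_eigenvector_def conj_action_eq_image by blast
  have "g *v (?h *v w) = w" by (simp add: matrix_vector_mul_assoc inv_GL2_mult[OF g])
  then have "?h *v w \<noteq> 0" using w(1) by auto
  moreover have "\<exists>c. A *v (?h *v w) = c *s (?h *v w)" if A: "A \<in> K" for A
  proof -
    obtain c where c: "(g ** A ** ?h) *v w = c *s w" using w(2)[OF A] by blast
    have "A *v (?h *v w) = (?h ** (g ** A ** ?h)) *v w"
      using inv_GL2_mult(1)[OF g] by (simp add: matrix_vector_mul_assoc matrix_mul_assoc)
    also have "\<dots> = ?h *v ((g ** A ** ?h) *v w)" by (rule matrix_vector_mul_assoc[symmetric])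
    also have "\<dots> = c *s (?h *v w)" unfolding c by (simp add: vector_scalar_commute)
    finally show ?thesis by blast
  qed
  ultimately show ?thesis unfolding has_common_eigenvector_def by blast
qed

lemma irreducible_group_imp_no_common_eigenvector:
  assumes "irreducible_group K"
  shows "\<not> has_common_eigenvector K"
proof
  assume "has_common_eigenvector K"
  then obtain w where w: "w \<noteq> 0" "\<And>A. A \<in> K \<Longrightarrow> \<exists>c. A *v w = c *s w"
    unfolding has_common_eigenvector_def by blast
  have "vec.independent {w}" using w(1) by (simp add: vec.dependent_single)
  then have "vec.dim {w} = 1" using vec.dim_eq_card_independent by fastforce
  then have "line (vec.span {w})" by (simp add: line_def)
  moreover have "(*v) A ` vec.span {w} \<subseteq> vec.span {w}" if A: "A \<in> K" for A
  proof -
    obtain c where "A *v w = c *s w" using w(2)[OF A] by blast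
    then have "A *v (k *s w) = (k * c) *s w" for k by (simp add: vector_scalar_commute)
    then show ?thesis by (auto simp: vec.span_singleton)
  qed
  ultimately show False using assms unfolding irreducible_group_def by blast
qed

lemma line_imp_range:
  assumes "line W"
  obtains v where "v \<noteq> 0" "W = range (\<lambda>k. k *s v)"
proof -
  obtain B where B: "B \<subseteq> W" "vec.independent B" "W \<subseteq> vec.span B" "card B = vec.dim W"
    using vec.basis_exists by blast
  then obtain v where v: "B = {v}" using assms by (auto simp: line_def card_1_singleton_iff)
  have "vec.span B \<subseteq> W" using assms B(1) by (intro vec.span_minimal) (auto simp: line_def)
  then have "W = range (\<lambda>k. k *s v)" using B(3) v by (auto simp: vec.span_singleton)
  moreover have "v \<noteq> 0" using B(2) v by (simp add: vec.dependent_single)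
  ultimately show thesis using that by blast
qed

lemma has_common_eigenvector_if_diag:
  assumes "\<And>A. A \<in> K \<Longrightarrow> \<exists>s t. A = diag2 s t"
  shows "has_common_eigenvector (K :: ('a::field^2^2) set)"
proof -
  define w :: "'a^2" where "w = vector [1, 0]"
  have w: "w $ 1 = 1" "w $ 2 = 0" by (simp_all add: w_def)
  then have "w \<noteq> 0" by auto
  moreover have "diag2 s t *v w = s *s w" for s t
    by (simp add: vec_eq_iff forall_2 matrix_vector_mult_def sum_2 w)
  ultimately show ?thesis using assms unfolding has_common_eigenvector_def by metis
qed

lemma monomial_groupI:
  assumes "subgroup K GL2" "\<not> has_common_eigenvector K"
    and "\<And>A. A \<in> K \<Longrightarrow> (\<exists>s t. A = diag2 s t) \<or> (\<exists>s t. A = adiag2 s t)"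
  shows "monomial_group K"
  using assms has_common_eigenvector_if_diag[of K] by (intro monomial_group.intro) blast+

text \<open>
  In a basis adapted to the decomposition the group acts by monomial matrices; the change of basis is
  the inverse of the matrix \<open>P\<close> whose columns are the basis vectors.
\<close>

lemma imprimitive_conj_monomial_group:
  assumes "subgroup K GL2" "imprimitive K"
  shows "\<exists>g. invertible g \<and> monomial_group (conj_action g K)"
proof -
  from assms(2) obtain V W where VW: "line V" "line W" "{x + y |x y. x \<in> V \<and> y \<in> W} = UNIV" "V \<inter> W = {0}"
    "\<forall>A\<in>K. (\<lambda>W. (*v) A ` W) ` {V, W} = {V, W}"
    unfolding imprimitive_def by (elim conjE exE) (rule that)
  obtain v where v: "v \<noteq> 0" "V = range (\<lambda>k. k *s v)" using line_imp_range[OF VW(1)] .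
  obtain w where w: "w \<noteq> 0" "W = range (\<lambda>k. k *s w)" using line_imp_range[OF VW(2)] .
  have inVW: "v \<in> V" "w \<in> W" unfolding v(2) w(2) by (metis rangeI vec.scale_one)+
  then have neq: "V \<noteq> W" using VW(4) v(1) by blast
  define P :: "'a^2^2" where "P = (\<chi> i j. if j = 1 then v $ i else w $ i)"
  have P: "P $ i $ 1 = v $ i" "P $ i $ 2 = w $ i" for i by (simp_all add: P_def)
  have Px: "P *v x = x $ 1 *s v + x $ 2 *s w" for x
    by (simp add: vec_eq_iff matrix_vector_mult_def sum_2 P mult.commute)
  have "surj ((*v) P)"
    unfolding surj_def
  proof
    fix y
    have "y \<in> {x + y |x y. x \<in> V \<and> y \<in> W}" using VW(3) by blast
    then obtain a b where "y = a *s v + b *s w" unfolding v(2) w(2) by blast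
    then have "y = P *v vector [a, b]" by (simp add: Px)
    then show "\<exists>x. y = P *v x" by blast
  qed
  then have P_inv: "invertible P"
    using matrix_right_invertible_surjective[of P] invertible_right_inverse[of P] by blast
  define g where "g = inv\<^bsub>GL2\<^esub> P"
  have g: "invertible g" "inv\<^bsub>GL2\<^esub> g = P"
    using inv_GL2_mult(3)[OF P_inv] GL2.inv_inv[of P] P_inv by (simp_all add: g_def)
  have "(\<exists>s t. g ** A ** P = diag2 s t) \<or> (\<exists>s t. g ** A ** P = adiag2 s t)" if A: "A \<in> K" for A
  proof -
    have conj: "g ** A ** P = M" if "A ** P = P ** M" for M
    proof -
      have "g ** A ** P = g ** P ** M" using that by (simp flip: matrix_mul_assoc)
      then show ?thesis using inv_GL2_mult(1)[OF P_inv] by (simp add: g_def)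
    qed
    have AV: "A *v v \<in> (*v) A ` V" "A *v w \<in> (*v) A ` W" using inVW by auto
    have "(*v) A ` V = V \<and> (*v) A ` W = W \<or> (*v) A ` V = W \<and> (*v) A ` W = V"
      using bspec[OF VW(5) A] neq by (auto simp: doubleton_eq_iff)
    then show ?thesis
    proof
      assume "(*v) A ` V = V \<and> (*v) A ` W = W"
      then obtain s t where "A *v v = s *s v" "A *v w = t *s w" using AV v(2) w(2) by auto
      then have "A ** P = P ** diag2 s t"
        by (simp add: vec_eq_iff forall_2 matrix_matrix_mult_def matrix_vector_mult_def sum_2 P mult.commute)
      then show ?thesis using conj by blast
    next
      assume "(*v) A ` V = W \<and> (*v) A ` W = V"
      then obtain s t where "A *v v = s *s w" "A *v w = t *s v" using AV v(2) w(2) by auto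
      then have "A ** P = P ** adiag2 t s"
        by (simp add: vec_eq_iff forall_2 matrix_matrix_mult_def matrix_vector_mult_def sum_2 P mult.commute)
      then show ?thesis using conj by blast
    qed
  qed
  moreover have "irreducible_group K" using assms(2) by (simp add: imprimitive_def)
  then have "\<not> has_common_eigenvector (conj_action g K)"
    using has_common_eigenvector_conj_action[OF g(1)] irreducible_group_imp_no_common_eigenvector
    by blast
  ultimately have "monomial_group (conj_action g K)"
    using subgroup_conj_action[OF g(1) assms(1)] g(2)
    by (intro monomial_groupI) (auto simp: conj_action_eq_image)
  then show ?thesis using g(1) by blast
qed

section \<open>The number of conjugacy classes\<close>

lemma isomorphic_imprimitive_conjugate:
  fixes H K :: "('a::{field,finite}^2^2) set"
  assumes "monomial_group H" "\<not> has_common_eigenvector H" "\<not> 8 dvd card H"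
    and "subgroup K GL2" "imprimitive K" "subgrp K \<cong> subgrp H"
  shows "\<exists>g. invertible g \<and> conj_action g K = H"
proof -
  obtain g where g: "invertible g" "monomial_group (conj_action g K)"
    using imprimitive_conj_monomial_group[OF assms(4,5)] by blast
  have "subgrp H \<cong> subgrp K"
    by (rule group.iso_sym[OF GL2.subgroup_imp_group[OF assms(4)] assms(6)])
  then obtain f where f: "f \<in> iso (subgrp H) (subgrp K)" unfolding is_iso_def by blast
  have isom: "isomorphic_monomial_groups H (conj_action g K) ((\<lambda>A. g ** A ** inv\<^bsub>GL2\<^esub> g) \<circ> f)"
    using assms(1,3) g iso_set_trans[OF f conj_action_iso[OF g(1), of K]]
    by (simp add: isomorphic_monomial_groups_def isomorphic_monomial_groups_axioms_def comp_def compose_def)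
  have "irreducible_group K" using assms(5) by (simp add: imprimitive_def)
  then have "\<not> has_common_eigenvector (conj_action g K)"
    using has_common_eigenvector_conj_action[OF g(1)] irreducible_group_imp_no_common_eigenvector
    by blast
  from isomorphic_monomial_groups.conjugate[OF isom assms(2) this]
  obtain h where h: "invertible h" "conj_action h (conj_action g K) = H" by blast
  have "invertible (h ** g)" by (rule invertible_mult[OF h(1) g(1)])
  moreover have "conj_action (h ** g) K = H"
    using h(2) conj_action_conj_action[OF h(1) g(1)] by simp
  ultimately show ?thesis by blast
qed

theorem theorem1p3:
  fixes p k q m :: nat and H :: "('a::{field,finite}^2^2) set"
  assumes "prime p" and "0 < k" and "q = p ^ k" and "CARD('a) = q"
    and "subgroup H GL2" and "H \<subseteq> M2"
    and "imprimitive H" and "cube_free_group (subgrp H)"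
    and "order (subgrp H) = m" and "\<not> p dvd m"
  shows "N_imp m H = 1"
proof -
  define E where "E = {K :: ('a^2^2) set. subgroup K GL2 \<and> imprimitive K \<and>
    order (subgrp K) = m \<and> subgrp K \<cong> subgrp H}"
  have no_eigenvector: "\<not> has_common_eigenvector H"
    using assms(7) by (intro irreducible_group_imp_no_common_eigenvector) (simp add: imprimitive_def)
  have monomial: "monomial_group H"
    using assms(5,6) no_eigenvector M2_cases by (intro monomial_groupI) auto
  have "\<not> 2 ^ 3 dvd order (subgrp H)"
    using assms(8) two_is_prime_nat unfolding cube_free_group_def by blast
  then have not8: "\<not> 8 dvd card H" by (simp add: order_def)
  have "subgrp H \<cong> subgrp H" by (rule iso_refl)
  then have "H \<in> E" using assms(5,7,9) by (simp add: E_def)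
  moreover have "orbit GL2 conj_action K = orbit GL2 conj_action H" if K: "K \<in> E" for K
  proof -
    obtain g where "invertible g" "conj_action g K = H"
      using isomorphic_imprimitive_conjugate[OF monomial no_eigenvector not8] K
      unfolding E_def by blast
    then show ?thesis using orbit_conj_action by metis
  qed
  ultimately have "orbits GL2 E conj_action = {orbit GL2 conj_action H}"
    unfolding orbits_def by blast
  then show ?thesis by (simp add: N_imp_def E_def)
qed

end
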